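(* For any real $q>0$, if $G$ is an $m$-edge graph with $\lambda(G)\ge \sqrt m+q$, then $$t(G)> q\cdot m .$$ This bound is asymptotically tight as witnessed by the split graphs.
   Context: Graphs are finite and simple. $\lambda(G)$ is the largest eigenvalue of the adjacency matrix of $G$, and $t(G)$ is the number of triangles of $G$. The split graphs are the graphs $S_{k,m}$ defined as follows: for integers $1\le k<m$, write $m-\binom{k}{2}=k\ell+r$ with integers $\ell\ge 0$ and $0\le r\le k-1$; then $S_{k,m}$ is the $m$-edge graph obtained from the join $K_k\vee \ell K_1$ (a clique $K_k$ completely joined to $\ell$ independent vertices) by adding one extra vertex that has exactly $r$ neighbors, all in the vertex set of $K_k$. *)

theory Defs
  imports
    "Graph_Theory.Pair_Digraph"
    "Jordan_Normal_Form.Spectral_Radius"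
    "HOL-Library.Landau_Symbols"
begin

text \<open>
  A finite simple graph is a \<^locale>\<open>pair_graph\<close>: a finite vertex set together with a
  symmetric irreflexive set of arcs, so each edge \<open>uv\<close> is present as the two arcs
  \<open>(u, v)\<close> and \<open>(v, u)\<close>.
\<close>

definition edge_set :: "'a pair_pre_digraph \<Rightarrow> 'a set set" where
  "edge_set G = {{u, v} |u v. (u, v) \<in> parcs G}"

definition num_edges :: "'a pair_pre_digraph \<Rightarrow> nat" where
  "num_edges G = card (edge_set G)"

definition triangles :: "'a pair_pre_digraph \<Rightarrow> 'a set set" where
  "triangles G = {T. T \<subseteq> pverts G \<and> card T = 3 \<and>
     (\<forall>u\<in>T. \<forall>v\<in>T. u \<noteq> v \<longrightarrow> (u, v) \<in> parcs G)}"

definition num_triangles :: "'a pair_pre_digraph \<Rightarrow> nat" where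
  "num_triangles G = card (triangles G)"

text \<open>
  The matrix type is indexed by \<open>0, \<dots>, n - 1\<close>, so the vertices are enumerated first. The
  enumeration is arbitrary; another one conjugates the matrix by a permutation matrix and
  leaves its eigenvalues unchanged.
\<close>

definition vertex_list :: "'a pair_pre_digraph \<Rightarrow> 'a list" where
  "vertex_list G = (SOME vs. distinct vs \<and> set vs = pverts G)"

definition adjacency_matrix :: "'a pair_pre_digraph \<Rightarrow> real mat" where
  "adjacency_matrix G = mat (card (pverts G)) (card (pverts G))
     (\<lambda>(i, j). if (vertex_list G ! i, vertex_list G ! j) \<in> parcs G then 1 else 0)"

text \<open>
  The adjacency matrix is real symmetric, so its real eigenvalues are all its eigenvalues. The
  value is meaningful only if the graph has at least one vertex.
\<close>

definition largest_eigenvalue :: "'a pair_pre_digraph \<Rightarrow> real" where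
  "largest_eigenvalue G = Max (spectrum (adjacency_matrix G))"

text \<open>
  The split graph \<open>S\<^sub>k\<^sub>,\<^sub>m\<close>, for \<open>1 \<le> k < m\<close> and \<open>k choose 2 \<le> m\<close> (equivalently \<open>\<ell> \<ge> 0\<close>);
  outside this range the subtraction of naturals is truncated and the definition is not
  meaningful. The clique is \<open>{..<k}\<close>, the independent set is \<open>{k..<k + \<ell>}\<close>, and the extra
  vertex is \<open>k + \<ell>\<close>, with neighbours \<open>{..<r}\<close>. It is isolated if \<open>r = 0\<close>.
\<close>

definition split_graph :: "nat \<Rightarrow> nat \<Rightarrow> nat pair_pre_digraph" where
  "split_graph k m =
    (let l = (m - (k choose 2)) div k;
         r = (m - (k choose 2)) mod k;
         A = {(u, v). u < v \<and> v < k}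
             \<union> {..<k} \<times> {k..<k + l}
             \<union> {..<r} \<times> {k + l}
     in \<lparr> pverts = {..k + l}, parcs = A \<union> A\<inverse> \<rparr>)"

lemma pair_graph_split_graph:
  assumes "1 \<le> k"
  shows "pair_graph (split_graph k m)"
proof -
  define l r where "l = (m - (k choose 2)) div k" and "r = (m - (k choose 2)) mod k"
  define A where "A = {(u, v). u < v \<and> v < k} \<union> {..<k} \<times> {k..<k + l} \<union> {..<r} \<times> {k + l}"
  have G: "split_graph k m = \<lparr> pverts = {..k + l}, parcs = A \<union> A\<inverse> \<rparr>"
    by (simp add: split_graph_def l_def r_def A_def Let_def)
  have r: "r < k" using assms by (simp add: r_def)
  have A: "A \<subseteq> {..k + l} \<times> {..k + l}" using r by (auto simp: A_def)
  have fin: "finite A" using A by (rule finite_subset) simp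
  have ne: "(u, u) \<notin> A" for u using r by (auto simp: A_def)
  show ?thesis
    using A fin ne unfolding G
    by unfold_locales (auto simp: symmetric_def intro!: symI)
qed

lemma num_edges_split_graph:
  assumes "1 \<le> k" "k choose 2 \<le> m"
  shows "num_edges (split_graph k m) = m"
proof -
  define l r where "l = (m - (k choose 2)) div k" and "r = (m - (k choose 2)) mod k"
  define A1 where "A1 = {(u, v). u < v \<and> v < k}"
  define A where "A = A1 \<union> {..<k} \<times> {k..<k + l} \<union> {..<r} \<times> {k + l}"
  have G: "parcs (split_graph k m) = A \<union> A\<inverse>"
    by (simp add: split_graph_def l_def r_def A_def A1_def Let_def)
  have r: "r < k" using assms by (simp add: r_def)
  have fin1: "finite A1"
    by (rule finite_subset[of _ "{..<k} \<times> {..<k}"]) (auto simp: A1_def)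
  have lt: "(u, v) \<in> A \<Longrightarrow> u < v" for u v using r by (auto simp: A_def A1_def)
  have A1: "card A1 = k choose 2"
  proof -
    have "A1 = (SIGMA v:{..<k}. {..<v}) \<inverse>" by (auto simp: A1_def)
    then have "card A1 = card (SIGMA v:{..<k}. {..<v})" by simp
    also have "\<dots> = (\<Sum>v<k. v)" by simp
    also have "\<dots> = k choose 2"
      by (induction k) (auto simp: numeral_2_eq_2)
    finally show ?thesis .
  qed
  have "edge_set (split_graph k m) = (\<lambda>(u, v). {u, v}) ` A"
    unfolding edge_set_def G by (auto simp: image_iff insert_commute)
  moreover have "inj_on (\<lambda>(u, v). {u, v}) A"
    by (auto simp: inj_on_def doubleton_eq_iff dest!: lt)
  ultimately have "num_edges (split_graph k m) = card A"
    by (simp add: num_edges_def card_image)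
  also have "card A = card (A1 \<union> {..<k} \<times> {k..<k + l}) + card ({..<r} \<times> {k + l})"
    unfolding A_def using fin1 r by (intro card_Un_disjoint) (auto simp: A1_def)
  also have "card (A1 \<union> {..<k} \<times> {k..<k + l}) = card A1 + card ({..<k} \<times> {k..<k + l})"
    using fin1 by (intro card_Un_disjoint) (auto simp: A1_def)
  also have "\<dots> + card ({..<r} \<times> {k + l}) = (k choose 2) + (k * l + r)"
    by (simp add: A1)
  also have "k * l + r = m - (k choose 2)"
    by (simp add: l_def r_def)
  finally show ?thesis using assms by simp
qed

end

theory Submission
  imports
    Defs
    "HOL-Analysis.Function_Topology"
    "HOL-Analysis.Convex"
    "HOL-Real_Asymp.Real_Asymp"
begin

text \<open>
  Let \<open>A\<close> be the adjacency matrix of \<open>G\<close>, with eigenvalues \<open>\<lambda> = \<lambda>\<^sub>1 \<ge> \<dots> \<ge> \<lambda>\<^sub>n\<close>. Counting closed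
  walks gives \<open>\<Sum> \<lambda>\<^sub>i\<^sup>2 = 2m\<close> and \<open>\<Sum> \<lambda>\<^sub>i\<^sup>3 = 6t\<close>. The sum of the cubes other than \<open>\<lambda>\<^sup>3\<close> is at
  least \<open>-(\<Sum>\<^bsub>i\<ge>2\<^esub> \<lambda>\<^sub>i\<^sup>2)\<^bsup>3/2\<^esup>\<close>, so \<open>6t \<ge> \<lambda>\<^sup>3 - (2m - \<lambda>\<^sup>2)\<^bsup>3/2\<^esup>\<close>. If \<open>\<lambda> \<ge> \<surd>m + q\<close>, then
  \<open>2m - \<lambda>\<^sup>2 \<le> (\<surd>m - q)\<^sup>2\<close>, and the bound becomes
  \<open>6t \<ge> (\<surd>m + q)\<^sup>3 - (\<surd>m - q)\<^sup>3 = 6qm + 2q\<^sup>3 > 6qm\<close>.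

  The full spectral decomposition can be avoided. With a unit eigenvector \<open>x\<close> of \<open>\<lambda>\<close>, the
  deflated matrix \<open>B = A - \<lambda> x x\<^sup>T\<close> satisfies \<open>tr B\<^sup>2 = 2m - \<lambda>\<^sup>2\<close> and \<open>tr B\<^sup>3 = 6t - \<lambda>\<^sup>3\<close>, and two
  applications of the Cauchy-Schwarz inequality give \<open>(tr B\<^sup>3)\<^sup>2 \<le> (tr B\<^sup>2)\<^sup>3\<close>
  (\<open>trace_cube_deviation\<close>). The only spectral fact needed is the variational description of
  \<open>\<lambda>\<close> (\<open>largest_eigenvalue_variational\<close>): the quadratic form attains its maximum on the unit
  sphere, and it does so at an eigenvector.

  For tightness, the variational principle with a test vector that is constant on the clique
  and on the independent set of the split graph gives \<open>\<lambda> \<ge> (k - 1)/2 + \<surd>(k\<ell>)\<close>, and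
  \<open>\<surd>(k\<ell>) - \<surd>m\<close> tends to \<open>0\<close>. The matching upper bound is the theorem itself: every triangle lies
  in the clique or has exactly one vertex outside it, so
  \<open>t \<le> T = (k choose 3) + (\<ell> + 1)(k choose 2)\<close>, and \<open>\<lambda> \<ge> \<surd>m + T/m\<close> would force \<open>t > T\<close>.
  Hence \<open>\<lambda> - \<surd>m < T/m\<close>, and \<open>T/m\<close> tends to \<open>(k - 1)/2\<close>. The ratio \<open>t/m\<close> lies between
  \<open>\<lambda> - \<surd>m\<close> and \<open>T/m\<close>, so it has the same limit.
\<close>

section \<open>The maximum of a quadratic form on the unit sphere\<close>

text \<open>
  First-order condition at a maximum, in algebraic form: a quadratic in \<open>e\<close> that vanishes at
  \<open>0\<close> and has constant sign has no linear term. The witness is \<open>e = g / (\<bar>c\<bar> + 1)\<close>.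
\<close>

lemma linear_term_zero:
  fixes g c :: real
  assumes "\<And>e. 2 * e * g \<le> e\<^sup>2 * c"
  shows "g = 0"
proof (rule ccontr)
  assume "g \<noteq> 0"
  define C where "C = \<bar>c\<bar> + 1"
  have C: "C > 0" "c < C" by (auto simp: C_def)
  have "2 * (g / C) * g \<le> (g / C)\<^sup>2 * c" by (rule assms)
  also have "\<dots> \<le> (g / C)\<^sup>2 * C" using C by (intro mult_left_mono) auto
  also have "\<dots> = (g / C) * g" using C by (simp add: power2_eq_square)
  finally have "g\<^sup>2 / C \<le> 0" by (simp add: power2_eq_square)
  then show False using C \<open>g \<noteq> 0\<close> by (simp add: divide_le_0_iff)
qed

text \<open>
  Vectors are functions on the index set, so the product topology and Tychonoff's theorem
  provide the compact sphere on which the maximum \<open>\<mu>\<close> is attained. Perturbing the maximizer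
  along a coordinate vector shows that it is an eigenvector for \<open>\<mu>\<close>.
\<close>

lemma symmetric_top_eigenvector:
  fixes a :: "'a \<Rightarrow> 'a \<Rightarrow> real"
  assumes fin: "finite V" and "V \<noteq> {}"
    and sym: "\<And>u v. u \<in> V \<Longrightarrow> v \<in> V \<Longrightarrow> a u v = a v u"
  obtains x \<mu> where "(\<Sum>v\<in>V. (x v)\<^sup>2) = 1"
    and "\<And>v. v \<in> V \<Longrightarrow> (\<Sum>u\<in>V. a v u * x u) = \<mu> * x v"
    and "\<And>y. (\<Sum>u\<in>V. \<Sum>v\<in>V. a u v * y u * y v) \<le> \<mu> * (\<Sum>v\<in>V. (y v)\<^sup>2)"
proof -
  define Q where "Q y = (\<Sum>u\<in>V. \<Sum>v\<in>V. a u v * y u * y v)" for y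
  define N :: "('a \<Rightarrow> real) \<Rightarrow> real" where "N y = (\<Sum>v\<in>V. (y v)\<^sup>2)" for y
  \<comment> \<open>Coordinates outside \<open>V\<close> are pinned to \<open>0\<close>; otherwise the set would not be compact.\<close>
  define K :: "('a \<Rightarrow> real) set" where "K = PiE UNIV (\<lambda>i. if i \<in> V then {-1..1} else {0})"
  have "compact K"
    unfolding compactin_euclidean_iff[symmetric] euclidean_product_topology[symmetric] K_def
    by (subst compactin_PiE) auto
  moreover have "closed {y. N y = 1}"
    unfolding N_def by (intro closed_Collect_eq continuous_intros) (auto intro!: continuous_intros)
  ultimately have "compact (K \<inter> {y. N y = 1})" by (rule compact_Int_closed)
  moreover obtain w where w: "w \<in> V" using \<open>V \<noteq> {}\<close> by auto
  have "(\<lambda>v. if v = w then 1 else 0) \<in> K \<inter> {y. N y = 1}"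
    using w fin by (auto simp: K_def N_def if_distrib[of "\<lambda>t. t\<^sup>2"] cong: if_cong)
  then have "K \<inter> {y. N y = 1} \<noteq> {}" by blast
  moreover have "continuous_on (K \<inter> {y. N y = 1}) Q"
    unfolding Q_def
    by (intro continuous_intros) (auto intro: continuous_on_product_coordinates continuous_on_subset)
  ultimately obtain x where x: "x \<in> K" "N x = 1"
    and max: "\<And>y. y \<in> K \<Longrightarrow> N y = 1 \<Longrightarrow> Q y \<le> Q x"
    using continuous_attains_sup[of "K \<inter> {y. N y = 1}" Q] by auto
  have bound: "Q y \<le> Q x * N y" for y
  proof (cases "N y = 0")
    case True
    then have "y v = 0" if "v \<in> V" for v
      using that fin by (auto simp: N_def sum_nonneg_eq_0_iff)
    then show ?thesis using True by (simp add: Q_def)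
  next
    case False
    have N0: "N y \<ge> 0" by (simp add: N_def sum_nonneg)
    with False have Np: "N y > 0" by simp
    define s where "s = sqrt (N y)"
    have s: "s > 0" "s\<^sup>2 = N y" using Np by (auto simp: s_def)
    define z where "z v = (if v \<in> V then y v / s else 0)" for v
    have Nz: "N z = 1"
    proof -
      have "N z = (\<Sum>v\<in>V. (y v)\<^sup>2 / s\<^sup>2)" unfolding N_def z_def
        by (intro sum.cong) (auto simp: power_divide)
      also have "\<dots> = N y / s\<^sup>2" by (simp add: N_def sum_divide_distrib)
      finally show ?thesis using s Np by simp
    qed
    have "z v \<in> {-1..1}" if "v \<in> V" for v
    proof -
      have "(z v)\<^sup>2 \<le> N z" unfolding N_def using that fin
        by (intro member_le_sum) auto
      then have "\<bar>z v\<bar> \<le> 1" unfolding Nz by (simp add: abs_square_le_1)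
      then show ?thesis by auto
    qed
    then have "z \<in> K" by (auto simp: K_def z_def)
    then have "Q z \<le> Q x" using Nz max by blast
    moreover have "Q z = Q y / s\<^sup>2" unfolding Q_def z_def sum_divide_distrib
      by (intro sum.cong) (auto simp: power2_eq_square)
    ultimately show ?thesis using s Np by (simp add: field_simps)
  qed
  have "(\<Sum>u\<in>V. a v u * x u) = Q x * x v" if v: "v \<in> V" for v
  proof -
    define g where "g = (\<Sum>u\<in>V. a v u * x u)"
    \<comment> \<open>\<open>d\<close> is the coordinate vector at \<open>v\<close>, along which the maximizer is perturbed.\<close>
    define d where "d u = (if u = v then 1 else 0 :: real)" for u
    have "2 * e * (g - Q x * x v) \<le> e\<^sup>2 * (Q x - a v v)" for e
    proof -
      have cross: "(\<Sum>u\<in>V. \<Sum>w\<in>V. a u w * d u * x w) = g"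
        "(\<Sum>u\<in>V. \<Sum>w\<in>V. a u w * x u * d w) = g"
        "(\<Sum>u\<in>V. \<Sum>w\<in>V. a u w * d u * d w) = a v v"
        using v fin sym unfolding d_def g_def
        by (simp_all add: if_distrib[of "\<lambda>t. t * _"] if_distrib[of "\<lambda>t. _ * t"]
             sum.delta sum.delta' sum.swap cong: if_cong sum.cong)
      have "Q (\<lambda>u. x u + e * d u) =
          (\<Sum>u\<in>V. \<Sum>w\<in>V. a u w * x u * x w + e * (a u w * d u * x w) + e * (a u w * x u * d w)
             + e\<^sup>2 * (a u w * d u * d w))"
        unfolding Q_def by (intro sum.cong refl) (simp add: algebra_simps power2_eq_square)
      also have "\<dots> = Q x + 2 * e * g + e\<^sup>2 * a v v"
        unfolding sum.distrib sum_distrib_left[symmetric] cross Q_def by simp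
      finally have 1: "Q (\<lambda>u. x u + e * d u) = Q x + 2 * e * g + e\<^sup>2 * a v v" .
      have "N (\<lambda>u. x u + e * d u) = (\<Sum>u\<in>V. (x u)\<^sup>2 + 2 * e * (x u * d u) + e\<^sup>2 * (d u)\<^sup>2)"
        unfolding N_def by (intro sum.cong refl) (simp add: algebra_simps power2_eq_square)
      also have "\<dots> = N x + 2 * e * (\<Sum>u\<in>V. x u * d u) + e\<^sup>2 * (\<Sum>u\<in>V. (d u)\<^sup>2)"
        unfolding sum.distrib sum_distrib_left[symmetric] N_def by simp
      also have "(\<Sum>u\<in>V. x u * d u) = x v"
        using v fin by (simp add: d_def if_distrib[of "\<lambda>t. _ * t"] cong: if_cong)
      also have "(\<Sum>u\<in>V. (d u)\<^sup>2) = 1"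
        using v fin by (simp add: d_def if_distrib[of "\<lambda>t. t\<^sup>2"] cong: if_cong)
      finally have 2: "N (\<lambda>u. x u + e * d u) = 1 + 2 * e * x v + e\<^sup>2" using x by simp
      show ?thesis using bound[of "\<lambda>u. x u + e * d u"] unfolding 1 2 by (simp add: algebra_simps)
    qed
    then have "g - Q x * x v = 0" by (rule linear_term_zero)
    then show ?thesis by (simp add: g_def)
  qed
  with that[of x "Q x"] x bound show thesis by (auto simp: Q_def N_def)
qed

section \<open>Traces after removing the top eigenvector\<close>

text \<open>
  With \<open>b = a - \<mu> x x\<^sup>T\<close>, the eigenvector equation makes all mixed terms collapse, so
  \<open>\<parallel>b\<parallel>\<^sup>2 = tr a\<^sup>2 - \<mu>\<^sup>2\<close> in the Frobenius norm and \<open>tr b\<^sup>3 = tr a\<^sup>3 - \<mu>\<^sup>3\<close>. Then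
  \<open>\<bar>tr b\<^sup>3\<bar> = \<bar>\<langle>b, b\<^sup>2\<rangle>\<bar> \<le> \<parallel>b\<parallel> \<parallel>b\<^sup>2\<parallel> \<le> \<parallel>b\<parallel>\<^sup>3\<close>; \<open>c\<close> below is \<open>b\<^sup>2\<close>.
\<close>

lemma trace_cube_deviation:
  fixes a :: "'a \<Rightarrow> 'a \<Rightarrow> real"
  assumes sym: "\<And>u v. u \<in> V \<Longrightarrow> v \<in> V \<Longrightarrow> a u v = a v u"
    and unit: "(\<Sum>v\<in>V. (x v)\<^sup>2) = 1"
    and ev: "\<And>v. v \<in> V \<Longrightarrow> (\<Sum>u\<in>V. a v u * x u) = \<mu> * x v"
  shows "((\<Sum>u\<in>V. \<Sum>v\<in>V. \<Sum>w\<in>V. a u v * a v w * a w u) - \<mu> ^ 3)\<^sup>2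
           \<le> ((\<Sum>u\<in>V. \<Sum>v\<in>V. (a u v)\<^sup>2) - \<mu>\<^sup>2) ^ 3"
    and "\<mu>\<^sup>2 \<le> (\<Sum>u\<in>V. \<Sum>v\<in>V. (a u v)\<^sup>2)"
proof -
  define b where "b u v = a u v - \<mu> * x u * x v" for u v
  define c where "c u w = (\<Sum>v\<in>V. b u v * b v w)" for u w
  have ev': "(\<Sum>v\<in>V. x v * a v u) = \<mu> * x u" if "u \<in> V" for u
    using ev[OF that] sym that by (simp add: mult.commute cong: sum.cong)
  have quad: "(\<Sum>u\<in>V. \<Sum>v\<in>V. a u v * x u * x v) = \<mu>"
  proof -
    have "(\<Sum>u\<in>V. \<Sum>v\<in>V. a u v * x u * x v) = (\<Sum>u\<in>V. x u * (\<Sum>v\<in>V. a u v * x v))"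
      by (simp add: sum_distrib_left algebra_simps)
    also have "\<dots> = (\<Sum>u\<in>V. \<mu> * (x u)\<^sup>2)"
      by (intro sum.cong refl) (simp add: ev power2_eq_square)
    finally show ?thesis using unit by (simp add: sum_distrib_left[symmetric])
  qed
  have c: "c u w = (\<Sum>v\<in>V. a u v * a v w) - \<mu>\<^sup>2 * x u * x w" if "u \<in> V" "w \<in> V" for u w
  proof -
    have "c u w = (\<Sum>v\<in>V. a u v * a v w - \<mu> * x w * (a u v * x v) - \<mu> * x u * (x v * a v w)
             + \<mu>\<^sup>2 * x u * x w * (x v)\<^sup>2)"
      unfolding c_def b_def by (intro sum.cong refl) (simp add: algebra_simps power2_eq_square)
    also have "\<dots> = (\<Sum>v\<in>V. a u v * a v w) - \<mu> * x w * (\<mu> * x u) - \<mu> * x u * (\<mu> * x w)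
             + \<mu>\<^sup>2 * x u * x w"
      by (simp only: sum.distrib sum_subtractf sum_distrib_left[symmetric] ev ev' unit that mult_1_right)
    finally show ?thesis by (simp add: algebra_simps power2_eq_square)
  qed
  have b2: "(\<Sum>u\<in>V. \<Sum>v\<in>V. (b u v)\<^sup>2) = (\<Sum>u\<in>V. \<Sum>v\<in>V. (a u v)\<^sup>2) - \<mu>\<^sup>2"
  proof -
    have "(\<Sum>u\<in>V. \<Sum>v\<in>V. (b u v)\<^sup>2) = (\<Sum>u\<in>V. \<Sum>v\<in>V. (a u v)\<^sup>2 - 2 * \<mu> * (a u v * x u * x v)
        + \<mu>\<^sup>2 * ((x u)\<^sup>2 * (x v)\<^sup>2))"
      unfolding b_def by (intro sum.cong refl) (simp add: algebra_simps power2_eq_square)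
    also have "\<dots> = (\<Sum>u\<in>V. \<Sum>v\<in>V. (a u v)\<^sup>2) - 2 * \<mu> * \<mu> + \<mu>\<^sup>2 * 1"
      by (simp only: sum.distrib sum_subtractf sum_distrib_left[symmetric] quad unit mult_1_right)
    finally show ?thesis by (simp add: power2_eq_square)
  qed
  have bsym: "b u v = b v u" if "u \<in> V" "v \<in> V" for u v
    using sym that by (simp add: b_def algebra_simps)
  have c2: "(\<Sum>u\<in>V. \<Sum>w\<in>V. (c u w)\<^sup>2) \<le> (\<Sum>u\<in>V. \<Sum>v\<in>V. (b u v)\<^sup>2)\<^sup>2"
  proof -
    have "(c u w)\<^sup>2 \<le> (\<Sum>v\<in>V. (b u v)\<^sup>2) * (\<Sum>v\<in>V. (b w v)\<^sup>2)" if "u \<in> V" "w \<in> V" for u w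
    proof -
      have "c u w = (\<Sum>v\<in>V. b u v * b w v)"
        unfolding c_def using bsym that by (intro sum.cong) auto
      then show ?thesis by (simp add: Cauchy_Schwarz_ineq_sum)
    qed
    then have "(\<Sum>u\<in>V. \<Sum>w\<in>V. (c u w)\<^sup>2) \<le> (\<Sum>u\<in>V. \<Sum>w\<in>V. (\<Sum>v\<in>V. (b u v)\<^sup>2) * (\<Sum>v\<in>V. (b w v)\<^sup>2))"
      by (intro sum_mono)
    also have "\<dots> = (\<Sum>u\<in>V. \<Sum>v\<in>V. (b u v)\<^sup>2)\<^sup>2"
      by (simp only: sum_product power2_eq_square)
    finally show ?thesis .
  qed
  have bc: "(\<Sum>u\<in>V. \<Sum>w\<in>V. b u w * c u w) =
      (\<Sum>u\<in>V. \<Sum>v\<in>V. \<Sum>w\<in>V. a u v * a v w * a w u) - \<mu> ^ 3"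
  proof -
    have walk: "(\<Sum>u\<in>V. \<Sum>w\<in>V. x u * x w * (\<Sum>v\<in>V. a u v * a v w)) = \<mu>\<^sup>2"
    proof -
      have "(\<Sum>u\<in>V. \<Sum>w\<in>V. x u * x w * (\<Sum>v\<in>V. a u v * a v w)) =
          (\<Sum>u\<in>V. \<Sum>w\<in>V. \<Sum>v\<in>V. x u * a u v * (a v w * x w))"
        by (simp add: sum_distrib_left algebra_simps)
      also have "\<dots> = (\<Sum>u\<in>V. \<Sum>v\<in>V. \<Sum>w\<in>V. x u * a u v * (a v w * x w))"
        by (rule sum.cong[OF refl], rule sum.swap)
      also have "\<dots> = (\<Sum>u\<in>V. \<Sum>v\<in>V. \<mu> * (a u v * x u * x v))"
        by (intro sum.cong refl) (simp add: sum_distrib_left[symmetric] ev)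
      also have "\<dots> = \<mu> * \<mu>" by (simp only: sum_distrib_left[symmetric] quad)
      finally show ?thesis by (simp add: power2_eq_square)
    qed
    have tr: "(\<Sum>u\<in>V. \<Sum>w\<in>V. a u w * (\<Sum>v\<in>V. a u v * a v w)) =
        (\<Sum>u\<in>V. \<Sum>v\<in>V. \<Sum>w\<in>V. a u v * a v w * a w u)"
    proof (rule sum.cong[OF refl])
      fix u assume u: "u \<in> V"
      have "(\<Sum>w\<in>V. a u w * (\<Sum>v\<in>V. a u v * a v w)) = (\<Sum>w\<in>V. \<Sum>v\<in>V. a u v * a v w * a w u)"
        using sym[OF u] by (simp add: sum_distrib_left algebra_simps cong: sum.cong)
      also have "\<dots> = (\<Sum>v\<in>V. \<Sum>w\<in>V. a u v * a v w * a w u)"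
        by (rule sum.swap)
      finally show "(\<Sum>w\<in>V. a u w * (\<Sum>v\<in>V. a u v * a v w)) = (\<Sum>v\<in>V. \<Sum>w\<in>V. a u v * a v w * a w u)" .
    qed
    have "(\<Sum>u\<in>V. \<Sum>w\<in>V. b u w * c u w) =
       (\<Sum>u\<in>V. \<Sum>w\<in>V. a u w * (\<Sum>v\<in>V. a u v * a v w) - \<mu>\<^sup>2 * (a u w * x u * x w)
          - \<mu> * (x u * x w * (\<Sum>v\<in>V. a u v * a v w)) + \<mu> ^ 3 * ((x u)\<^sup>2 * (x w)\<^sup>2))"
      by (intro sum.cong refl)
         (simp add: c b_def algebra_simps power2_eq_square power3_eq_cube)
    also have "\<dots> = (\<Sum>u\<in>V. \<Sum>v\<in>V. \<Sum>w\<in>V. a u v * a v w * a w u) - \<mu>\<^sup>2 * \<mu> - \<mu> * \<mu>\<^sup>2 + \<mu> ^ 3 * 1"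
      by (simp only: sum.distrib sum_subtractf sum_distrib_left[symmetric] quad unit mult_1_right walk tr)
    finally show ?thesis by (simp add: power2_eq_square power3_eq_cube)
  qed
  have "(\<Sum>u\<in>V. \<Sum>w\<in>V. b u w * c u w)\<^sup>2
      \<le> (\<Sum>u\<in>V. \<Sum>w\<in>V. (b u w)\<^sup>2) * (\<Sum>u\<in>V. \<Sum>w\<in>V. (c u w)\<^sup>2)"
    using Cauchy_Schwarz_ineq_sum[of "\<lambda>(u, w). b u w" "\<lambda>(u, w). c u w" "V \<times> V"]
    by (simp add: sum.cartesian_product case_prod_unfold)
  also have "\<dots> \<le> (\<Sum>u\<in>V. \<Sum>w\<in>V. (b u w)\<^sup>2) * (\<Sum>u\<in>V. \<Sum>w\<in>V. (b u w)\<^sup>2)\<^sup>2"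
    by (intro mult_left_mono c2 sum_nonneg) auto
  finally show "((\<Sum>u\<in>V. \<Sum>v\<in>V. \<Sum>w\<in>V. a u v * a v w * a w u) - \<mu> ^ 3)\<^sup>2
           \<le> ((\<Sum>u\<in>V. \<Sum>v\<in>V. (a u v)\<^sup>2) - \<mu>\<^sup>2) ^ 3"
    unfolding bc b2 by (simp add: power3_eq_cube power2_eq_square mult.assoc)
  have "0 \<le> (\<Sum>u\<in>V. \<Sum>v\<in>V. (b u v)\<^sup>2)" by (intro sum_nonneg) auto
  then show "\<mu>\<^sup>2 \<le> (\<Sum>u\<in>V. \<Sum>v\<in>V. (a u v)\<^sup>2)" unfolding b2 by simp
qed

text \<open>
  The bounds \<open>\<surd>m + q \<le> l\<close> and \<open>l\<^sup>2 \<le> 2m\<close> force \<open>q < \<surd>m\<close>, so the square root of \<open>(\<surd>m - q)\<^sup>6\<close> is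
  \<open>(\<surd>m - q)\<^sup>3\<close>.
\<close>

lemma cube_deviation_arith:
  fixes l m q t :: real
  assumes q: "q > 0" and m: "m \<ge> 0" and l: "l \<ge> sqrt m + q" and l2: "l\<^sup>2 \<le> 2 * m"
    and dev: "(6 * t - l ^ 3)\<^sup>2 \<le> (2 * m - l\<^sup>2) ^ 3"
  shows "t > q * m"
proof -
  define s where "s = sqrt m"
  have s: "s \<ge> 0" "s\<^sup>2 = m" using m by (auto simp: s_def)
  have l': "l \<ge> s + q" using l by (simp add: s_def)
  have sq: "(s + q)\<^sup>2 \<le> l\<^sup>2" using l' s q by (intro power_mono) auto
  have "(s + q)\<^sup>2 \<le> 2 * s\<^sup>2" using sq l2 s by simp
  have "s > q"
  proof (rule ccontr)
    assume "\<not> s > q"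
    then have "(s + s)\<^sup>2 \<le> (s + q)\<^sup>2" using s by (intro power_mono) auto
    moreover have "(s + s)\<^sup>2 = 4 * s\<^sup>2" by (simp add: power2_eq_square)
    ultimately have "s\<^sup>2 \<le> 0" using \<open>(s + q)\<^sup>2 \<le> 2 * s\<^sup>2\<close> by linarith
    then have "s = 0" by simp
    then show False using \<open>(s + q)\<^sup>2 \<le> 2 * s\<^sup>2\<close> q by simp
  qed
  have "2 * m - l\<^sup>2 \<le> (s - q)\<^sup>2"
    using sq zero_le_power2[of q] unfolding power2_sum power2_diff s(2) by linarith
  then have "(2 * m - l\<^sup>2) ^ 3 \<le> ((s - q)\<^sup>2) ^ 3"
    using l2 by (intro power_mono) auto
  also have "\<dots> = ((s - q) ^ 3)\<^sup>2" by (simp add: power_mult[symmetric])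
  finally have "(6 * t - l ^ 3)\<^sup>2 \<le> ((s - q) ^ 3)\<^sup>2" using dev by simp
  then have "\<bar>6 * t - l ^ 3\<bar> \<le> \<bar>(s - q) ^ 3\<bar>"
    unfolding abs_le_square_iff .
  also have "\<dots> = (s - q) ^ 3" using \<open>s > q\<close> by simp
  finally have "\<bar>6 * t - l ^ 3\<bar> \<le> (s - q) ^ 3" .
  then have "6 * t \<ge> l ^ 3 - (s - q) ^ 3" by linarith
  moreover have "l ^ 3 \<ge> (s + q) ^ 3" using l' s q by (intro power_mono) auto
  moreover have "(s + q) ^ 3 - (s - q) ^ 3 = 6 * (q * m) + 2 * q ^ 3"
    unfolding s(2)[symmetric] by (simp add: power3_eq_cube power2_eq_square algebra_simps)
  moreover have "q ^ 3 > 0" using q by simp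
  ultimately show ?thesis by linarith
qed


section \<open>The largest eigenvalue of a graph as a maximum\<close>

text \<open>
  The adjacency matrix indexed by the vertices themselves, which frees the arguments from
  the arbitrary enumeration of the vertices.
\<close>

definition adj :: "'a pair_pre_digraph \<Rightarrow> 'a \<Rightarrow> 'a \<Rightarrow> real" where
  "adj G u v = of_bool ((u, v) \<in> parcs G)"

lemma eigenvalue_adjacency_matrix_iff:
  assumes fin: "finite (pverts G)"
  shows "eigenvalue (adjacency_matrix G) \<mu> \<longleftrightarrow>
    (\<exists>x. (\<exists>v\<in>pverts G. x v \<noteq> 0) \<and>
      (\<forall>v\<in>pverts G. (\<Sum>u\<in>pverts G. adj G v u * x u) = \<mu> * x v))" (is "_ \<longleftrightarrow> (\<exists>x. ?P x)")
proof -
  define V where "V = pverts G"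
  define n where "n = card V"
  define e where "e i = vertex_list G ! i" for i
  have vs: "distinct (vertex_list G)" "set (vertex_list G) = V"
    using someI_ex[OF finite_distinct_list[OF fin, unfolded conj_commute[of "set _ = _"]]]
    unfolding vertex_list_def V_def by auto
  then have "length (vertex_list G) = n" by (simp add: n_def distinct_card[symmetric])
  then have e: "bij_betw e {..<n} V"
    unfolding e_def using vs by (intro bij_betw_nth) auto
  have A: "adjacency_matrix G = mat n n (\<lambda>(i, j). adj G (e i) (e j))"
    unfolding adjacency_matrix_def adj_def e_def n_def V_def by (intro cong_mat) auto
  have ev: "eigenvector (adjacency_matrix G) (vec n (\<lambda>i. x (e i))) \<mu> \<longleftrightarrow> ?P x" for x
  proof -
    have row: "(adjacency_matrix G *\<^sub>v vec n (\<lambda>i. x (e i))) $ i = (\<Sum>u\<in>V. adj G (e i) u * x u)"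
      if "i < n" for i
      using that
      by (simp add: A scalar_prod_def sum.reindex_bij_betw[OF e, symmetric] atLeast0LessThan)
    have all: "(\<forall>v\<in>V. R v) \<longleftrightarrow> (\<forall>i<n. R (e i))" for R
      using e by (auto simp: bij_betw_def)
    have "vec n (\<lambda>i. x (e i)) = 0\<^sub>v n \<longleftrightarrow> (\<forall>v\<in>V. x v = 0)"
      unfolding all by (auto simp: vec_eq_iff)
    moreover have "adjacency_matrix G *\<^sub>v vec n (\<lambda>i. x (e i)) = \<mu> \<cdot>\<^sub>v vec n (\<lambda>i. x (e i))
      \<longleftrightarrow> (\<forall>v\<in>V. (\<Sum>u\<in>V. adj G v u * x u) = \<mu> * x v)"
      unfolding all by (subst vec_eq_iff) (auto simp: row simp del: index_mult_mat_vec, simp_all add: A)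
    moreover have "dim_row (adjacency_matrix G) = n" by (simp add: A)
    ultimately show ?thesis unfolding eigenvector_def V_def by auto
  qed
  have rep: "\<exists>x. y = vec n (\<lambda>i. x (e i))" if "y \<in> carrier_vec n" for y :: "real vec"
  proof (intro exI)
    show "y = vec n (\<lambda>i. (\<lambda>v. y $ the_inv_into {..<n} e v) (e i))"
      using that e by (auto simp: vec_eq_iff bij_betw_def the_inv_into_f_f)
  qed
  have "dim_row (adjacency_matrix G) = n" by (simp add: A)
  then have "eigenvalue (adjacency_matrix G) \<mu> \<longleftrightarrow>
      (\<exists>y\<in>carrier_vec n. eigenvector (adjacency_matrix G) y \<mu>)"
    unfolding eigenvalue_def by (auto simp: eigenvector_def)
  also have "\<dots> \<longleftrightarrow> (\<exists>x. eigenvector (adjacency_matrix G) (vec n (\<lambda>i. x (e i))) \<mu>)"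
    using rep by fastforce
  finally show ?thesis unfolding ev .
qed

context pair_graph
begin

lemma adj_sym: "adj G u v = adj G v u"
  unfolding adj_def using pair_sym_arcs
  by (intro arg_cong[where f = of_bool]) (auto simp: symmetric_def dest: symD)

text \<open>
  The maximum of the quadratic form is an eigenvalue, and it bounds every other eigenvalue
  because the form takes the value \<open>\<nu> \<parallel>y\<parallel>\<^sup>2\<close> at an eigenvector \<open>y\<close> for \<open>\<nu>\<close>. This also shows
  that the real spectrum is nonempty, so that its \<open>Max\<close> is meaningful.
\<close>

lemma largest_eigenvalue_variational:
  assumes "pverts G \<noteq> {}"
  shows "\<exists>x. (\<Sum>v\<in>pverts G. (x v)\<^sup>2) = 1 \<and>
      (\<forall>v\<in>pverts G. (\<Sum>u\<in>pverts G. adj G v u * x u) = largest_eigenvalue G * x v)"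
    and "(\<Sum>u\<in>pverts G. \<Sum>v\<in>pverts G. adj G u v * y u * y v)
           \<le> largest_eigenvalue G * (\<Sum>v\<in>pverts G. (y v)\<^sup>2)"
proof -
  define V where "V = pverts G"
  have fin: "finite V" using pair_finite_verts by (simp add: V_def)
  obtain x \<mu> where x: "(\<Sum>v\<in>V. (x v)\<^sup>2) = 1"
    "\<And>v. v \<in> V \<Longrightarrow> (\<Sum>u\<in>V. adj G v u * x u) = \<mu> * x v"
    and ray: "\<And>y. (\<Sum>u\<in>V. \<Sum>v\<in>V. adj G u v * y u * y v) \<le> \<mu> * (\<Sum>v\<in>V. (y v)\<^sup>2)"
    using symmetric_top_eigenvector[OF fin, of "adj G"] assms adj_sym unfolding V_def by blast
  have iff: "\<nu> \<in> spectrum (adjacency_matrix G) \<longleftrightarrow> (\<exists>x. (\<exists>v\<in>V. x v \<noteq> 0) \<and>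
      (\<forall>v\<in>V. (\<Sum>u\<in>V. adj G v u * x u) = \<nu> * x v))" for \<nu>
    unfolding spectrum_def V_def using eigenvalue_adjacency_matrix_iff[OF pair_finite_verts] by simp
  have "\<exists>v\<in>V. x v \<noteq> 0"
  proof (rule ccontr)
    assume "\<not> ?thesis"
    then have "(\<Sum>v\<in>V. (x v)\<^sup>2) = 0" by simp
    with x show False by simp
  qed
  then have mem: "\<mu> \<in> spectrum (adjacency_matrix G)"
    unfolding iff using x(2) by (intro exI[of _ x] conjI ballI)
  have le: "\<nu> \<le> \<mu>" if \<nu>: "\<nu> \<in> spectrum (adjacency_matrix G)" for \<nu>
  proof -
    obtain y where y1: "\<exists>v\<in>V. y v \<noteq> 0"
      and y2: "\<forall>v\<in>V. (\<Sum>u\<in>V. adj G v u * y u) = \<nu> * y v"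
      using \<nu> unfolding iff by blast
    have y: "(\<Sum>u\<in>V. adj G v u * y u) = \<nu> * y v" if "v \<in> V" for v
      using y2 that by (rule bspec)
    have "(\<Sum>u\<in>V. \<Sum>v\<in>V. adj G u v * y u * y v) = (\<Sum>u\<in>V. y u * (\<Sum>v\<in>V. adj G u v * y v))"
      by (simp add: sum_distrib_left algebra_simps)
    also have "\<dots> = (\<Sum>u\<in>V. \<nu> * (y u)\<^sup>2)"
      by (intro sum.cong refl) (simp add: y power2_eq_square)
    finally have "\<nu> * (\<Sum>v\<in>V. (y v)\<^sup>2) \<le> \<mu> * (\<Sum>v\<in>V. (y v)\<^sup>2)"
      using ray[of y] by (simp add: sum_distrib_left)
    moreover have "(\<Sum>v\<in>V. (y v)\<^sup>2) > 0"
      using y1 fin by (auto intro: sum_pos2)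
    ultimately show ?thesis by simp
  qed
  have "adjacency_matrix G \<in> carrier_mat (card V) (card V)"
    by (simp add: adjacency_matrix_def V_def)
  then have "finite (spectrum (adjacency_matrix G))" by (rule card_finite_spectrum)
  then have top: "largest_eigenvalue G = \<mu>"
    unfolding largest_eigenvalue_def using mem le by (intro Max_eqI)
  show "\<exists>x. (\<Sum>v\<in>pverts G. (x v)\<^sup>2) = 1 \<and>
      (\<forall>v\<in>pverts G. (\<Sum>u\<in>pverts G. adj G v u * x u) = largest_eigenvalue G * x v)"
    using x unfolding top V_def by (intro exI[of _ x]) simp
  show "(\<Sum>u\<in>pverts G. \<Sum>v\<in>pverts G. adj G u v * y u * y v)
           \<le> largest_eigenvalue G * (\<Sum>v\<in>pverts G. (y v)\<^sup>2)"
    using ray unfolding top V_def .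
qed

section \<open>Closed walks of length two and three\<close>

text \<open>Every edge carries exactly two arcs.\<close>

lemma sum_adj_sq: "(\<Sum>u\<in>pverts G. \<Sum>v\<in>pverts G. (adj G u v)\<^sup>2) = 2 * real (num_edges G)"
proof -
  define f where "f = (\<lambda>(u, v). {u, v :: 'a})"
  have sq: "(adj G u v)\<^sup>2 = of_bool ((u, v) \<in> parcs G)" for u v by (simp add: adj_def)
  have sub: "parcs G \<subseteq> pverts G \<times> pverts G" using wellformed' by auto
  have "(\<Sum>u\<in>pverts G. \<Sum>v\<in>pverts G. (adj G u v)\<^sup>2) =
      (\<Sum>p\<in>pverts G \<times> pverts G. of_bool (p \<in> parcs G))"
    by (simp only: sq sum.cartesian_product case_prod_unfold prod.collapse)
  also have "\<dots> = real (card (parcs G))"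
    using sub pair_finite_verts by (simp add: Int_absorb1 Int_absorb2)
  also have "card (parcs G) = (\<Sum>e\<in>edge_set G. card {p \<in> parcs G. f p = e})"
  proof -
    have "edge_set G = f ` parcs G" by (auto simp: edge_set_def f_def)
    then show ?thesis
      using sum.image_gen[OF pair_finite_arcs, of "\<lambda>_. 1::nat" f] by simp
  qed
  also have "\<dots> = (\<Sum>e\<in>edge_set G. 2)"
  proof (intro sum.cong refl)
    fix e assume "e \<in> edge_set G"
    then obtain u v where e: "e = {u, v}" "(u, v) \<in> parcs G" by (auto simp: edge_set_def)
    then have "(v, u) \<in> parcs G" "u \<noteq> v"
      using pair_sym_arcs pair_no_loops[of "(u, v)"] by (auto simp: symmetric_def sym_def)
    with e have "{p \<in> parcs G. f p = e} = {(u, v), (v, u)}"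
      by (auto simp: f_def doubleton_eq_iff)
    then show "card {p \<in> parcs G. f p = e} = 2" using \<open>u \<noteq> v\<close> by simp
  qed
  finally show ?thesis by (simp add: num_edges_def)
qed

text \<open>
  In a loop-free graph the vertices of a closed walk of length three are distinct, so each
  triangle comes from its six orderings and nothing else is counted.
\<close>

lemma sum_adj_cycle:
  "(\<Sum>u\<in>pverts G. \<Sum>v\<in>pverts G. \<Sum>w\<in>pverts G. adj G u v * adj G v w * adj G w u)
     = 6 * real (num_triangles G)"
proof -
  define W where "W = {(u, v, w). (u, v) \<in> parcs G \<and> (v, w) \<in> parcs G \<and> (w, u) \<in> parcs G}"
  define f where "f = (\<lambda>(u, v, w). {u, v, w :: 'a})"
  have walk: "adj G u v * adj G v w * adj G w u = of_bool ((u, v, w) \<in> W)" for u v w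
    by (simp add: adj_def W_def)
  have sub: "W \<subseteq> pverts G \<times> pverts G \<times> pverts G" using wellformed' by (auto simp: W_def)
  have ne: "u \<noteq> v" if "(u, v) \<in> parcs G" for u v using pair_no_loops[OF that] by simp
  have sy: "(v, u) \<in> parcs G" if "(u, v) \<in> parcs G" for u v
    using that pair_sym_arcs by (auto simp: symmetric_def sym_def)
  have finW: "finite W" using sub pair_finite_verts finite_subset by blast
  have finT: "finite (triangles G)"
    using pair_finite_verts
    by (intro finite_subset[of "triangles G" "Pow (pverts G)"]) (auto simp: triangles_def)
  have "(\<Sum>u\<in>pverts G. \<Sum>v\<in>pverts G. \<Sum>w\<in>pverts G. adj G u v * adj G v w * adj G w u) =
      (\<Sum>p\<in>pverts G \<times> pverts G \<times> pverts G. of_bool (p \<in> W))"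
    by (simp only: walk sum.cartesian_product case_prod_unfold prod.collapse)
  also have "\<dots> = real (card W)"
    using sub pair_finite_verts by (simp add: Int_absorb1 Int_absorb2)
  also have "card W = (\<Sum>T\<in>triangles G. card {p \<in> W. f p = T})"
  proof -
    have "f ` W \<subseteq> triangles G"
    proof
      fix T assume "T \<in> f ` W"
      then obtain u v w where T: "T = {u, v, w}" "(u, v) \<in> parcs G" "(v, w) \<in> parcs G" "(w, u) \<in> parcs G"
        by (auto simp: W_def f_def)
      then have "u \<noteq> v" "v \<noteq> w" "w \<noteq> u" using ne by blast+
      then show "T \<in> triangles G" using T sy wellformed' by (auto simp: triangles_def)
    qed
    from sum.group[OF finW finT this, of "\<lambda>_. 1::nat"] show ?thesis by simp
  qed
  also have "\<dots> = (\<Sum>T\<in>triangles G. 6)"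
  proof (intro sum.cong refl)
    fix T assume T: "T \<in> triangles G"
    then obtain a b c where abc: "T = {a, b, c}" "a \<noteq> b" "b \<noteq> c" "a \<noteq> c"
      by (auto simp: triangles_def card_3_iff)
    have fiber: "{p \<in> W. f p = T} = {(a, b, c), (a, c, b), (b, a, c), (b, c, a), (c, a, b), (c, b, a)}"
      (is "?L = ?R")
    proof
      show "?R \<subseteq> ?L" using T abc by (auto simp: W_def f_def triangles_def)
      show "?L \<subseteq> ?R"
      proof
        fix p assume "p \<in> ?L"
        then obtain u v w where p: "p = (u, v, w)" "u \<noteq> v" "v \<noteq> w" "w \<noteq> u" "{u, v, w} = T"
          using ne by (cases p) (auto simp: W_def f_def)
        have "u \<in> {a, b, c}" "v \<in> {a, b, c}" "w \<in> {a, b, c}"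
          unfolding abc(1)[symmetric] p(5)[symmetric] by simp_all
        then show "p \<in> ?R" unfolding p(1) using p(2-4)
          by (elim insertE emptyE) simp_all
      qed
    qed
    show "card {p \<in> W. f p = T} = 6" unfolding fiber using abc(2-4) by simp
  qed
  finally show ?thesis by (simp add: num_triangles_def)
qed

section \<open>The lower bound on the number of triangles\<close>

lemma num_triangles_gt:
  assumes "q > 0" "pverts G \<noteq> {}" "largest_eigenvalue G \<ge> sqrt (real (num_edges G)) + q"
  shows "real (num_triangles G) > q * real (num_edges G)"
proof -
  obtain x where x: "(\<Sum>v\<in>pverts G. (x v)\<^sup>2) = 1"
    "\<forall>v\<in>pverts G. (\<Sum>u\<in>pverts G. adj G v u * x u) = largest_eigenvalue G * x v"
    using largest_eigenvalue_variational(1)[OF assms(2)] by (elim exE conjE)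
  note dev = trace_cube_deviation[where V = "pverts G" and a = "adj G", OF adj_sym x(1) bspec[OF x(2)],
      unfolded sum_adj_sq sum_adj_cycle]
  show ?thesis using cube_deviation_arith[OF assms(1) _ assms(3) dev(2) dev(1)] by simp
qed

end

section \<open>Tightness for split graphs\<close>

text \<open>
  The neighbours of the last vertex \<open>k + l\<close> are left unspecified: it contributes a bounded
  number of edges and triangles, which does not affect the asymptotics.
\<close>

lemma split_graph_arcs:
  fixes k m :: nat
  assumes k: "k \<ge> 1"
  defines "l \<equiv> (m - (k choose 2)) div k"
  shows "pverts (split_graph k m) = {..k + l}"
    and "u < k \<Longrightarrow> v < k \<Longrightarrow> (u, v) \<in> parcs (split_graph k m) \<longleftrightarrow> u \<noteq> v"
    and "u < k \<Longrightarrow> k \<le> v \<Longrightarrow> v < k + l \<Longrightarrow> (u, v) \<in> parcs (split_graph k m)"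
    and "k \<le> u \<Longrightarrow> k \<le> v \<Longrightarrow> (u, v) \<notin> parcs (split_graph k m)"
proof -
  define r where "r = (m - (k choose 2)) mod k"
  define A where "A = {(u, v). u < v \<and> v < k} \<union> {..<k} \<times> {k..<k + l} \<union> {..<r} \<times> {k + l}"
  have G: "split_graph k m = \<lparr> pverts = {..k + l}, parcs = A \<union> A\<inverse> \<rparr>"
    by (simp add: split_graph_def l_def r_def A_def Let_def)
  have r: "r \<le> k" using k by (simp add: r_def less_imp_le)
  show "pverts (split_graph k m) = {..k + l}" by (simp add: G)
  show "u < k \<Longrightarrow> v < k \<Longrightarrow> (u, v) \<in> parcs (split_graph k m) \<longleftrightarrow> u \<noteq> v"
    and "u < k \<Longrightarrow> k \<le> v \<Longrightarrow> v < k + l \<Longrightarrow> (u, v) \<in> parcs (split_graph k m)"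
    by (auto simp: G A_def)
  show "k \<le> u \<Longrightarrow> k \<le> v \<Longrightarrow> (u, v) \<notin> parcs (split_graph k m)"
    using r by (auto simp: G A_def)
qed

text \<open>
  The bound is a lower estimate of the largest eigenvalue of \<open>K\<^sub>k \<or> l K\<^sub>1\<close>, namely the positive
  root \<open>\<mu>\<close> of \<open>\<mu>\<^sup>2 = (k - 1)\<mu> + kl\<close>. The corresponding eigenvector, extended by \<open>0\<close> to the
  extra vertex, is used as a test vector in the variational principle.
\<close>

lemma split_graph_largest_eigenvalue_ge:
  fixes k m :: nat
  assumes k: "k \<ge> 2"
  defines "l \<equiv> (m - (k choose 2)) div k"
  shows "largest_eigenvalue (split_graph k m) \<ge> (real k - 1) / 2 + sqrt (real (k * l))"
proof -
  let ?G = "split_graph k m"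
  interpret pair_graph ?G using k by (intro pair_graph_split_graph) simp
  have k1: "k \<ge> 1" using k by simp
  note arcs = split_graph_arcs[where k = k and m = m, OF k1, folded l_def]
  define c where "c = (real k - 1) / 2"
  define \<mu> where "\<mu> = c + sqrt (c\<^sup>2 + real (k * l))"
  have root: "\<mu> * \<mu> = (real k - 1) * \<mu> + real l * real k"
  proof -
    have "(\<mu> - c)\<^sup>2 = c\<^sup>2 + real (k * l)" unfolding \<mu>_def by simp
    then show ?thesis by (simp add: c_def power2_eq_square algebra_simps)
  qed
  define y where "y v = (if v < k then \<mu> else if v < k + l then real k else 0)" for v :: nat
  have V: "{..k + l} = {..<k} \<union> {k..<k + l} \<union> {k + l}" by auto
  have split: "(\<Sum>v\<le>k + l. h v) = (\<Sum>v<k. h v) + (\<Sum>v\<in>{k..<k + l}. h v) + h (k + l)"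
    for h :: "nat \<Rightarrow> real"
    unfolding V by (subst sum.union_disjoint; (subst sum.union_disjoint)?) auto
  have pull: "(\<Sum>v\<le>k + l. adj ?G u v * y u * y v) = y u * (\<Sum>v\<le>k + l. adj ?G u v * y v)" for u
    by (simp add: sum_distrib_left mult.assoc mult.left_commute)
  have row: "(\<Sum>v\<le>k + l. adj ?G u v * y u * y v) = \<mu> * (y u)\<^sup>2" if u: "u \<le> k + l" for u
  proof -
    consider "u < k" | "k \<le> u" "u < k + l" | "u = k + l" using u by linarith
    then show ?thesis
    proof cases
      case 1
      have "(\<Sum>v<k. adj ?G u v * y v) = (\<Sum>v\<in>{..<k} - {u}. \<mu>)"
        using 1 by (intro sum.mono_neutral_cong_right) (auto simp: adj_def arcs y_def)
      also have "\<dots> = (real k - 1) * \<mu>" using 1 by (simp add: of_nat_diff)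
      finally have "(\<Sum>v\<le>k + l. adj ?G u v * y v) = (real k - 1) * \<mu> + real l * real k"
        using 1 by (simp add: split adj_def arcs y_def)
      then show ?thesis unfolding pull root[symmetric] using 1
        by (simp add: y_def power2_eq_square)
    next
      case 2
      have "adj ?G u v = 1" if "v < k" for v
        using 2 that arcs(3)[of v u] adj_sym[of u v] by (simp add: adj_def)
      then have "(\<Sum>v\<le>k + l. adj ?G u v * y v) = real k * \<mu>"
        using 2 by (simp add: split y_def) (simp add: adj_def arcs)
      then show ?thesis unfolding pull using 2
        by (simp add: y_def power2_eq_square)
    next
      case 3
      then show ?thesis by (simp add: y_def)
    qed
  qed
  have "(\<Sum>u\<le>k + l. \<Sum>v\<le>k + l. adj ?G u v * y u * y v) = \<mu> * (\<Sum>u\<le>k + l. (y u)\<^sup>2)"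
    by (simp add: row sum_distrib_left)
  moreover have "(\<Sum>u\<le>k + l. \<Sum>v\<le>k + l. adj ?G u v * y u * y v)
      \<le> largest_eigenvalue ?G * (\<Sum>v\<le>k + l. (y v)\<^sup>2)"
    using largest_eigenvalue_variational(2)[of y] unfolding arcs(1) by simp
  ultimately have le: "\<mu> * (\<Sum>u\<le>k + l. (y u)\<^sup>2) \<le> largest_eigenvalue ?G * (\<Sum>u\<le>k + l. (y u)\<^sup>2)"
    by simp
  have "c > 0" using k by (simp add: c_def)
  then have "\<mu> > 0" unfolding \<mu>_def by (simp add: add_pos_nonneg)
  then have "(\<Sum>u\<le>k + l. (y u)\<^sup>2) > 0"
    using k by (intro sum_pos2[of _ 0]) (auto simp: y_def)
  with le have "\<mu> \<le> largest_eigenvalue ?G" by simp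
  moreover have "c + sqrt (real (k * l)) \<le> \<mu>" unfolding \<mu>_def by simp
  ultimately show ?thesis by (simp add: c_def)
qed

text \<open>
  No two vertices outside the clique are adjacent, so a triangle is a triple of clique
  vertices, or a pair of clique vertices together with one of the \<open>l + 1\<close> outer vertices.
\<close>

lemma num_triangles_split_graph_le:
  fixes k m :: nat
  assumes k: "k \<ge> 1"
  defines "l \<equiv> (m - (k choose 2)) div k"
  shows "num_triangles (split_graph k m) \<le> (k choose 3) + (l + 1) * (k choose 2)"
proof -
  let ?G = "split_graph k m"
  note arcs = split_graph_arcs[where k = k and m = m, OF k, folded l_def]
  define P where "P j = {S. S \<subseteq> {..<k} \<and> card S = j}" for j
  define apex where "apex = (\<lambda>(w, S). insert w S :: nat set)"
  have P: "finite (P j)" "card (P j) = k choose j" for j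
    by (auto simp: P_def n_subsets)
  have "triangles ?G \<subseteq> P 3 \<union> apex ` ({k..k + l} \<times> P 2)"
  proof
    fix T assume "T \<in> triangles ?G"
    then have T: "T \<subseteq> {..k + l}" "card T = 3" "\<And>u v. u \<in> T \<Longrightarrow> v \<in> T \<Longrightarrow> u \<noteq> v \<Longrightarrow> (u, v) \<in> parcs ?G"
      by (auto simp: triangles_def arcs)
    show "T \<in> P 3 \<union> apex ` ({k..k + l} \<times> P 2)"
    proof (cases "T \<subseteq> {..<k}")
      case True
      then show ?thesis using T by (simp add: P_def)
    next
      case False
      then obtain w where w: "w \<in> T" "k \<le> w" by (meson lessThan_iff not_less subsetI)
      have "T - {w} \<subseteq> {..<k}"
        using T(3)[OF w(1)] arcs(4) w(2) by (metis DiffE insertI1 lessThan_iff not_less subsetI)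
      then have "T - {w} \<in> P 2" using w T by (simp add: P_def card_Diff_singleton)
      moreover have "T = apex (w, T - {w})" using w by (auto simp: apex_def)
      moreover have "w \<in> {k..k + l}" using w T by auto
      ultimately show ?thesis by blast
    qed
  qed
  then have "num_triangles ?G \<le> card (P 3 \<union> apex ` ({k..k + l} \<times> P 2))"
    unfolding num_triangles_def using P by (intro card_mono) auto
  also have "\<dots> \<le> card (P 3) + card ({k..k + l} \<times> P 2)"
    using P by (intro order_trans[OF card_Un_le] add_left_mono card_image_le) auto
  finally show ?thesis by (simp add: P)
qed

text \<open>
  \<open>U m\<close> below is an upper estimate of \<open>T/m\<close>, where \<open>T\<close> is the bound of the previous lemma. It
  bounds \<open>d m\<close> from above by the contrapositive of \<open>num_triangles_gt\<close>.
\<close>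

lemma split_graph_asymptotics:
  fixes k :: nat
  assumes k: "k \<ge> 2"
  defines "d \<equiv> \<lambda>m. largest_eigenvalue (split_graph k m) - sqrt (real m)"
    and "t \<equiv> \<lambda>m. real (num_triangles (split_graph k m))"
  shows "d \<longlonglongrightarrow> (real k - 1) / 2" and "(\<lambda>m. t m / real m) \<longlonglongrightarrow> (real k - 1) / 2"
proof -
  define c where "c = (real k - 1) / 2"
  define c2 where "c2 = real (k choose 2)"
  define c3 where "c3 = real (k choose 3)"
  define l where "l m = (m - (k choose 2)) div k" for m
  have c: "c > 0" using k by (simp add: c_def)
  have c2: "c2 = real k * c"
  proof -
    have "even (k * (k - 1))" by auto
    then have "2 * (k choose 2) = k * (k - 1)" unfolding choose_two by (rule dvd_mult_div_cancel)
    then have "real (2 * (k choose 2)) = real (k * (k - 1))" by simp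
    then have "2 * c2 = real k * (real k - 1)" using k by (simp add: c2_def of_nat_diff)
    then show ?thesis by (simp add: c_def)
  qed
  have c3: "c3 \<ge> 0" by (simp add: c3_def)
  have kl: "real m - (c2 + real k) \<le> real (k * l m)" "real (k * l m) \<le> real m"
    if "m \<ge> k choose 2" for m
  proof -
    have "(m - (k choose 2)) mod k < k" using k by simp
    moreover have "k * l m + (m - (k choose 2)) mod k = m - (k choose 2)"
      unfolding l_def by simp
    ultimately have "m \<le> k * l m + (k choose 2) + k" "k * l m \<le> m"
      using that by linarith+
    then show "real m - (c2 + real k) \<le> real (k * l m)" "real (k * l m) \<le> real m"
      unfolding c2_def by linarith+
  qed
  define U where "U m = c3 / real m + c + c2 / real m" for m
  have ev1: "\<forall>\<^sub>F m in sequentially. m \<ge> max 1 (k choose 2)" by (rule eventually_ge_at_top)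
  have low: "\<forall>\<^sub>F m in sequentially. c + (sqrt (real m - (c2 + real k)) - sqrt (real m)) \<le> d m"
    using ev1
  proof eventually_elim
    case (elim m)
    have "sqrt (real m - (c2 + real k)) \<le> sqrt (real (k * l m))" using kl elim by simp
    then show ?case
      using split_graph_largest_eigenvalue_ge[OF k, of m, folded l_def] unfolding d_def c_def by linarith
  qed
  have tU: "\<forall>\<^sub>F m in sequentially. t m / real m \<le> U m \<and> d m < U m"
    using ev1
  proof eventually_elim
    case (elim m)
    interpret pair_graph "split_graph k m" using k by (intro pair_graph_split_graph) simp
    have m: "real m > 0" "num_edges (split_graph k m) = m"
      using elim k by (auto intro: num_edges_split_graph)
    have "real (num_triangles (split_graph k m)) \<le> real ((k choose 3) + (l m + 1) * (k choose 2))"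
      unfolding of_nat_le_iff l_def using k by (intro num_triangles_split_graph_le) simp
    then have "t m \<le> c3 + real (l m) * c2 + c2"
      by (simp add: t_def c3_def c2_def algebra_simps)
    moreover have "real (l m) * c2 \<le> c * real m"
      using mult_right_mono[OF kl(2)[of m], of c] elim c by (simp add: c2 algebra_simps)
    moreover have "U m * real m = c3 + c * real m + c2"
      using m by (simp add: U_def field_simps)
    ultimately have t: "t m \<le> U m * real m" by linarith
    have "U m > 0" using c c2 c3 by (simp add: U_def add_nonneg_pos add_pos_nonneg)
    have "d m < U m"
    proof (rule ccontr)
      assume "\<not> d m < U m"
      then have "t m > U m * real m"
        using num_triangles_gt[OF \<open>U m > 0\<close>] split_graph_arcs(1)[of k m] k
        unfolding d_def t_def m by simp
      with t show False by simp
    qed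
    with t m show ?case by (simp add: field_simps)
  qed
  have limU: "U \<longlonglongrightarrow> c" unfolding U_def by real_asymp
  have limL: "(\<lambda>m. c + (sqrt (real m - (c2 + real k)) - sqrt (real m))) \<longlonglongrightarrow> c" by real_asymp
  have "\<forall>\<^sub>F m in sequentially. d m \<le> U m" using tU by eventually_elim simp
  from tendsto_sandwich[OF low this limL limU] have d: "d \<longlonglongrightarrow> c" .
  then show "d \<longlonglongrightarrow> (real k - 1) / 2" by (simp add: c_def)
  \<comment> \<open>Once \<open>d m\<close> is positive, it is itself an admissible \<open>q\<close> in the triangle bound.\<close>
  have "\<forall>\<^sub>F m in sequentially. d m \<le> t m / real m"
    using ev1 order_tendstoD(1)[OF d c]
  proof eventually_elim
    case (elim m)
    interpret pair_graph "split_graph k m" using k by (intro pair_graph_split_graph) simp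
    have m: "real m > 0" "num_edges (split_graph k m) = m"
      using elim k by (auto intro: num_edges_split_graph)
    have "t m > d m * real m"
      using num_triangles_gt[OF elim(2)] split_graph_arcs(1)[of k m] k
      unfolding d_def t_def m by simp
    then show ?case using m by (simp add: field_simps)
  qed
  moreover have "\<forall>\<^sub>F m in sequentially. t m / real m \<le> U m" using tU by eventually_elim simp
  ultimately have "(\<lambda>m. t m / real m) \<longlonglongrightarrow> c" using d limU by (rule tendsto_sandwich)
  then show "(\<lambda>m. t m / real m) \<longlonglongrightarrow> (real k - 1) / 2" by (simp add: c_def)
qed

theorem theorem1p2:
  shows "(\<forall>(q :: real) (G :: 'a pair_pre_digraph).
            q > 0 \<longrightarrow> pair_graph G \<longrightarrow> pverts G \<noteq> {} \<longrightarrow>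
            largest_eigenvalue G \<ge> sqrt (real (num_edges G)) + q \<longrightarrow>
            real (num_triangles G) > q * real (num_edges G))
       \<and> (\<forall>k::nat. k \<ge> 2 \<longrightarrow>
            ((\<lambda>m. largest_eigenvalue (split_graph k m) - sqrt (real m))
               \<longlonglongrightarrow> (real k - 1) / 2) \<and>
            (\<lambda>m. real (num_triangles (split_graph k m))) \<sim>[sequentially]
            (\<lambda>m. (largest_eigenvalue (split_graph k m) - sqrt (real m)) * real m))"
proof (intro conjI allI impI)
  fix q :: real and G :: "'a pair_pre_digraph"
  assume "q > 0" "pair_graph G" "pverts G \<noteq> {}"
    "largest_eigenvalue G \<ge> sqrt (real (num_edges G)) + q"
  then show "real (num_triangles G) > q * real (num_edges G)"
    by (intro pair_graph.num_triangles_gt)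
next
  fix k :: nat assume k: "k \<ge> 2"
  note lim = split_graph_asymptotics[OF k]
  show "(\<lambda>m. largest_eigenvalue (split_graph k m) - sqrt (real m)) \<longlonglongrightarrow> (real k - 1) / 2"
    by (rule lim)
  have "(real k - 1) / 2 \<noteq> 0" using k by simp
  from tendsto_divide[OF lim(2) lim(1) this] this
  have "(\<lambda>m. real (num_triangles (split_graph k m)) /
      ((largest_eigenvalue (split_graph k m) - sqrt (real m)) * real m)) \<longlonglongrightarrow> 1"
    by (simp add: mult.commute)
  then show "(\<lambda>m. real (num_triangles (split_graph k m))) \<sim>[sequentially]
      (\<lambda>m. (largest_eigenvalue (split_graph k m) - sqrt (real m)) * real m)"
    by (rule asymp_equivI')
qed

end
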